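(* $\mathsf{non}(\mathsf{S}_{fin}(\mathcal{B}_\Omega,\mathcal{B}_\mathrm{T}))=\mathsf{non}(\mathsf{S}_{fin}(\Omega,\mathrm{T}))=\mathfrak{p}$.
   Context: All spaces $X$ are infinite sets of reals; all covers considered are assumed not to contain $X$ as a member. A cover is an $\omega$-cover of $X$ if every finite subset of $X$ lies in some member; large if each point lies in infinitely many members. A large cover $\mathcal{U}$ is a $\tau$-cover if for all $x,y\in X$, either ($x\in U\Rightarrow y\in U$) for all but finitely many $U\in\mathcal{U}$, or ($y\in U\Rightarrow x\in U$) for all but finitely many $U\in\mathcal{U}$. $\Omega,\mathrm{T}$ are the collections of countable open $\omega$-, $\tau$-covers; $\mathcal{B}_\Omega,\mathcal{B}_\mathrm{T}$ their countable Borel analogues. $X$ satisfies $\mathsf{S}_{fin}(\mathfrak{U},\mathfrak{V})$ if for every sequence $(\mathcal{U}_n)$ of members of $\mathfrak{U}$ there are finite (possibly empty) $\mathcal{F}_n\subseteq\mathcal{U}_n$ with $\bigcup_n\mathcal{F}_n\in\mathfrak{V}$. For a class $\mathcal{J}$ of sets of reals, $\mathsf{non}(\mathcal{J})$ is the minimal cardinality of a set of reals not in $\mathcal{J}$. $\mathfrak{p}$ is the minimal size of a centered family $Y$ of infinite subsets of $\mathbb{N}$ (every nonempty finite subfamily has infinite intersection) having no pseudo-intersection (an infinite $a\subseteq\mathbb{N}$ with $a\setminus b$ finite for all $b\in Y$). *)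

theory Defs
  imports "HOL-Analysis.Analysis"
begin

unbundle cardinal_syntax

text \<open>A space is a set \<open>X\<close> of reals with the subspace topology, so that the members of a cover
  are subsets of \<open>X\<close> and the convention that \<open>X\<close> is not a member of its covers has content.\<close>

definition is_cover :: "real set \<Rightarrow> real set set \<Rightarrow> bool" where
  "is_cover X \<U> \<longleftrightarrow> \<Union>\<U> = X \<and> X \<notin> \<U>"

definition omega_cover :: "real set \<Rightarrow> real set set \<Rightarrow> bool" where
  "omega_cover X \<U> \<longleftrightarrow> is_cover X \<U> \<and> (\<forall>F. finite F \<and> F \<subseteq> X \<longrightarrow> (\<exists>U\<in>\<U>. F \<subseteq> U))"

definition large_cover :: "real set \<Rightarrow> real set set \<Rightarrow> bool" where
  "large_cover X \<U> \<longleftrightarrow> is_cover X \<U> \<and> (\<forall>x\<in>X. infinite {U \<in> \<U>. x \<in> U})"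

definition tau_cover :: "real set \<Rightarrow> real set set \<Rightarrow> bool" where
  "tau_cover X \<U> \<longleftrightarrow> large_cover X \<U> \<and>
     (\<forall>x\<in>X. \<forall>y\<in>X. finite {U \<in> \<U>. \<not> (x \<in> U \<longrightarrow> y \<in> U)} \<or> finite {U \<in> \<U>. \<not> (y \<in> U \<longrightarrow> x \<in> U)})"

definition open_family :: "real set \<Rightarrow> real set set \<Rightarrow> bool" where
  "open_family X \<U> \<longleftrightarrow> (\<forall>U\<in>\<U>. openin (top_of_set X) U)"

definition borel_family :: "real set \<Rightarrow> real set set \<Rightarrow> bool" where
  "borel_family X \<U> \<longleftrightarrow> \<U> \<subseteq> sets (restrict_space borel X)"

definition Omega :: "real set \<Rightarrow> real set set set" where
  "Omega X = {\<U>. countable \<U> \<and> open_family X \<U> \<and> omega_cover X \<U>}"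

definition Tau :: "real set \<Rightarrow> real set set set" where
  "Tau X = {\<U>. countable \<U> \<and> open_family X \<U> \<and> tau_cover X \<U>}"

definition B_Omega :: "real set \<Rightarrow> real set set set" where
  "B_Omega X = {\<U>. countable \<U> \<and> borel_family X \<U> \<and> omega_cover X \<U>}"

definition B_Tau :: "real set \<Rightarrow> real set set set" where
  "B_Tau X = {\<U>. countable \<U> \<and> borel_family X \<U> \<and> tau_cover X \<U>}"

definition S_fin ::
  "(real set \<Rightarrow> real set set set) \<Rightarrow> (real set \<Rightarrow> real set set set) \<Rightarrow> real set \<Rightarrow> bool" where
  "S_fin \<AA> \<BB> X \<longleftrightarrow>
     (\<forall>\<U> :: nat \<Rightarrow> real set set. (\<forall>n. \<U> n \<in> \<AA> X) \<longrightarrow>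
        (\<exists>\<F>. (\<forall>n. finite (\<F> n) \<and> \<F> n \<subseteq> \<U> n) \<and> (\<Union>n. \<F> n) \<in> \<BB> X))"

text \<open>Cardinal numbers are rendered as cardinal orders, which are determined only up to \<open>=o\<close> and
  live over different types for sets of reals and for families of sets of naturals. Being the
  minimal cardinality is therefore a relation; it includes that the minimum is attained.\<close>

definition is_min_card :: "('a set \<Rightarrow> bool) \<Rightarrow> 'b rel \<Rightarrow> bool" where
  "is_min_card P \<kappa> \<longleftrightarrow>
     Card_order \<kappa> \<and> (\<exists>A. P A \<and> |A| =o \<kappa>) \<and> (\<forall>A. P A \<longrightarrow> \<kappa> \<le>o |A| )"

definition is_non :: "(real set \<Rightarrow> bool) \<Rightarrow> 'b rel \<Rightarrow> bool" where
  "is_non J \<kappa> \<longleftrightarrow> is_min_card (\<lambda>X. infinite X \<and> \<not> J X) \<kappa>"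

definition centered :: "nat set set \<Rightarrow> bool" where
  "centered Y \<longleftrightarrow> (\<forall>a\<in>Y. infinite a) \<and>
     (\<forall>F. finite F \<and> F \<noteq> {} \<and> F \<subseteq> Y \<longrightarrow> infinite (\<Inter>F))"

definition pseudo_intersection :: "nat set \<Rightarrow> nat set set \<Rightarrow> bool" where
  "pseudo_intersection a Y \<longleftrightarrow> infinite a \<and> (\<forall>b\<in>Y. finite (a - b))"

definition is_pseudointersection_number :: "'b rel \<Rightarrow> bool" where
  "is_pseudointersection_number \<kappa> \<longleftrightarrow>
     is_min_card (\<lambda>Y. centered Y \<and> \<not> (\<exists>a. pseudo_intersection a Y)) \<kappa>"

end

theory Submission
  imports Defs
begin

text \<open>For the lower bound, enumerate \<open>\<U> n = {U n m | m}\<close>. The traces \<open>{(n, m). x \<in> U n m}\<close> for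
  \<open>x \<in> X\<close>, together with the sets \<open>{(n, m). n \<ge> k}\<close>, form a centered family of size \<open>|X|\<close>, and a
  pseudo-intersection of it is a selection with finite columns in which every point belongs to
  almost all of the selected sets.

  For the upper bound, let \<open>Y\<close> be centered without pseudo-intersection and pass to
  \<open>Y' = Y \<union> {u \<union> - v | u v. u \<in> Y \<and> v \<in> Y}\<close>, which is centered of the same size. No infinite \<open>a\<close>
  meets all members of \<open>Y'\<close> in infinite sets that are linearly ordered modulo finite: pick
  \<open>v \<in> Y\<close> with \<open>a - v\<close> infinite and compare \<open>v\<close> with \<open>u \<union> - v\<close> on \<open>a\<close>; the only possibility is
  \<open>a \<inter> v \<subseteq>* u\<close>, so that \<open>a \<inter> v\<close> is a pseudo-intersection of \<open>Y\<close>. Embedding \<open>Y'\<close> into the reals,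
  the coordinate sets \<open>{y. n \<in> y}\<close> yield an open \<open>\<omega>\<close>-cover without a \<open>\<tau>\<close>-subcover.\<close>

section \<open>The lower bound\<close>

text \<open>Members at which \<open>x \<in> V \<longrightarrow> y \<in> V\<close> fails all miss
  \<open>y\<close>, and only finitely many do, so both alternatives of a \<tau>-cover hold. Such
  families are the \<gamma>-covers.\<close>

lemma tau_cover_if_cofinite:
  assumes inf: "infinite \<V>" and sub: "\<Union>\<V> \<subseteq> X" and "X \<notin> \<V>"
    and cof: "\<And>x. x \<in> X \<Longrightarrow> finite {V \<in> \<V>. x \<notin> V}"
  shows "tau_cover X \<V>"
proof -
  have large: "infinite {V \<in> \<V>. x \<in> V}" if "x \<in> X" for x
  proof
    assume "finite {V \<in> \<V>. x \<in> V}"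
    with cof[OF that] have "finite ({V \<in> \<V>. x \<in> V} \<union> {V \<in> \<V>. x \<notin> V})" by blast
    moreover have "{V \<in> \<V>. x \<in> V} \<union> {V \<in> \<V>. x \<notin> V} = \<V>" by blast
    ultimately show False using inf by simp
  qed
  have "X \<subseteq> \<Union>\<V>"
  proof
    fix x assume "x \<in> X"
    from not_finite_existsD[OF large[OF this]] show "x \<in> \<Union>\<V>" by blast
  qed
  moreover have "finite {V \<in> \<V>. \<not> (x \<in> V \<longrightarrow> y \<in> V)}" if "y \<in> X" for x y
    by (rule finite_subset[OF _ cof[OF that]]) auto
  ultimately show ?thesis
    using sub \<open>X \<notin> \<V>\<close> large unfolding tau_cover_def large_cover_def is_cover_def by simp
qed

text \<open>Almost containment in every tail of columns forces finite columns: column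
  \<open>n\<close> lies outside the tail that starts at \<open>Suc n\<close>.\<close>

lemma finite_column:
  assumes "finite (a - {c. Suc n \<le> fst (prod_decode c)})"
  shows "finite {m. prod_encode (n, m) \<in> a}"
proof -
  have "(\<lambda>m. prod_encode (n, m)) ` {m. prod_encode (n, m) \<in> a}
      \<subseteq> a - {c. Suc n \<le> fst (prod_decode c)}"
    by (rule image_subsetI) simp
  then have "finite ((\<lambda>m. prod_encode (n, m)) ` {m. prod_encode (n, m) \<in> a})"
    using assms by (rule finite_subset)
  then show ?thesis by (rule finite_imageD) (simp add: inj_on_def)
qed

text \<open>Assumption \<open>ps\<close> expresses that \<open>|X|\<close> is below the
  pseudo-intersection number, without referring to that number.\<close>

lemma S_fin_B_Omega_B_Tau_if_pseudo_intersections: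
  assumes X: "infinite X"
    and ps: "\<And>Y :: nat set set. |Y| \<le>o |X| \<Longrightarrow> centered Y \<Longrightarrow> \<exists>a. pseudo_intersection a Y"
  shows "S_fin B_Omega B_Tau X"
  unfolding S_fin_def
proof (intro allI impI)
  fix \<U> :: "nat \<Rightarrow> real set set"
  assume \<U>: "\<forall>n. \<U> n \<in> B_Omega X"
  have cnt: "countable (\<U> n)" and bor: "borel_family X (\<U> n)" and om: "omega_cover X (\<U> n)" for n
    using \<U> by (auto simp: B_Omega_def)
  have ne: "\<U> n \<noteq> {}" for n
    using om[of n] unfolding omega_cover_def by blast
  define U where "U n m = from_nat_into (\<U> n) m" for n m
  have rU: "range (U n) = \<U> n" for n
    unfolding U_def using range_from_nat_into[OF ne cnt] .
  define W where "W c = U (fst (prod_decode c)) (snd (prod_decode c))" for c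
  define b where "b x = {c. x \<in> W c}" for x
  define cl where "cl k = {c. k \<le> fst (prod_decode c)}" for k :: nat
  define G where "G = b ` X \<union> range cl"
  have "|b ` X| \<le>o |X|" by (rule card_of_image)
  moreover have "|range cl| \<le>o |X|"
    using card_of_image[of cl UNIV] X infinite_iff_card_of_nat ordLeq_transitive by blast
  ultimately have "|G| \<le>o |X|"
    unfolding G_def using X by (intro card_of_Un_ordLeq_infinite_Field)
        (simp_all add: Field_card_of card_of_card_order_on)
  moreover have fip: "infinite (\<Inter>H)" if H: "finite H" "H \<subseteq> G" for H
  proof -
    have "finite (H \<inter> b ` X)" "H \<inter> b ` X \<subseteq> b ` X" using H by auto
    then obtain F where F: "F \<subseteq> X" "finite F" "H \<inter> b ` X = b ` F"
      by (metis finite_subset_image)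
    have "finite (H \<inter> range cl)" "H \<inter> range cl \<subseteq> range cl" using H by auto
    then obtain K where K: "finite K" "H \<inter> range cl = cl ` K"
      by (metis finite_subset_image)
    obtain k where k: "\<forall>i\<in>K. i \<le> k" using K(1) finite_nat_set_iff_bounded_le by blast
    have "\<exists>m. F \<subseteq> U n m" for n
    proof -
      obtain V where "V \<in> \<U> n" "F \<subseteq> V" using om[of n] F unfolding omega_cover_def by blast
      then show ?thesis using rU[of n] by (metis rangeE)
    qed
    then obtain m where m: "\<And>n. F \<subseteq> U n (m n)" by metis
    \<comment> \<open>\<open>k\<close> bounds the tails occurring in \<open>H\<close>. Each column
      from \<open>k\<close> on contributes one code, naming a member of that cover that contains
      \<open>F\<close>.\<close>
    define g where "g i = prod_encode (k + i, m (k + i))" for i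
    have "inj g" by (auto simp: inj_def g_def)
    then have "infinite (range g)" by (simp add: finite_image_iff)
    moreover have "range g \<subseteq> \<Inter>H"
    proof (intro subsetI InterI)
      fix c h assume "c \<in> range g" "h \<in> H"
      then obtain i where c: "c = g i" by blast
      consider x where "x \<in> F" "h = b x" | l where "l \<in> K" "h = cl l"
      proof -
        have "h \<in> b ` F \<or> h \<in> cl ` K"
          using \<open>h \<in> H\<close> H(2) unfolding F(3)[symmetric] K(2)[symmetric] G_def by auto
        then show thesis using that by auto
      qed
      then show "c \<in> h"
      proof cases
        case 1
        then have "x \<in> U (k + i) (m (k + i))" using m by blast
        then show ?thesis by (simp add: 1 c b_def W_def g_def)
      next
        case 2
        then have "l \<le> k + i" using k trans_le_add1 by blast
        then show ?thesis by (simp add: 2 c cl_def g_def)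
      qed
    qed
    ultimately show ?thesis using infinite_super by blast
  qed
  then have "centered G"
    unfolding centered_def using fip[of "{_}"] by simp
  ultimately obtain a where "pseudo_intersection a G"
    using ps by meson
  then have a: "infinite a" "\<And>g. g \<in> G \<Longrightarrow> finite (a - g)"
    unfolding pseudo_intersection_def by simp_all
  define \<F> where "\<F> n = U n ` {m. prod_encode (n, m) \<in> a}" for n
  have "finite (\<F> n)" for n
  proof -
    have "finite (a - cl (Suc n))" by (rule a(2)) (simp add: G_def)
    then have "finite {m. prod_encode (n, m) \<in> a}" unfolding cl_def by (rule finite_column)
    then show ?thesis unfolding \<F>_def by simp
  qed
  moreover have \<F>sub: "\<F> n \<subseteq> \<U> n" for n
    unfolding \<F>_def using rU[of n] by blast
  moreover have "(\<Union>n. \<F> n) \<in> B_Tau X"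
  proof -
    define \<V> where "\<V> = (\<Union>n. \<F> n)"
    have \<V>: "\<V> = W ` a"
    proof (intro equalityI subsetI)
      fix V assume "V \<in> \<V>"
      then obtain n m where "prod_encode (n, m) \<in> a" "V = U n m"
        unfolding \<V>_def \<F>_def by blast
      then have "prod_encode (n, m) \<in> a" "V = W (prod_encode (n, m))" by (simp_all add: W_def)
      then show "V \<in> W ` a" by blast
    next
      fix V assume "V \<in> W ` a"
      then obtain c where c: "c \<in> a" "V = W c" by blast
      then have "V \<in> \<F> (fst (prod_decode c))" unfolding \<F>_def W_def by simp
      then show "V \<in> \<V>" unfolding \<V>_def by blast
    qed
    have mem: "V \<noteq> X \<and> V \<subseteq> X" if "V \<in> \<V>" for V
      using that \<F>sub om unfolding \<V>_def omega_cover_def is_cover_def by blast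
    have fin: "finite {c \<in> a. x \<notin> W c}" if "x \<in> X" for x
    proof -
      have "finite (a - b x)" using a(2) that by (simp add: G_def)
      moreover have "a - b x = {c \<in> a. x \<notin> W c}" by (auto simp: b_def)
      ultimately show ?thesis by simp
    qed
    \<comment> \<open>Several codes in \<open>a\<close> may name the same set. Were \<V> finite,
      some \<open>W c0\<close> would be named infinitely often. As each point is missed by only
      finitely many codes, \<open>W c0\<close> would be all of \<open>X\<close>, which no cover has
      as a member.\<close>
    have inf: "infinite \<V>"
    proof
      assume "finite \<V>"
      then obtain c0 where c0: "c0 \<in> a" "infinite {c \<in> a. W c = W c0}"
        using pigeonhole_infinite[OF a(1)] \<V> by blast
      have "x \<in> W c0" if "x \<in> X" for x
      proof (rule ccontr)
        assume "x \<notin> W c0"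
        then have "{c \<in> a. W c = W c0} \<subseteq> {c \<in> a. x \<notin> W c}" by auto
        then show False using fin[OF that] c0(2) finite_subset by blast
      qed
      then show False using mem[of "W c0"] c0(1) \<V> by blast
    qed
    have "finite {V \<in> \<V>. x \<notin> V}" if "x \<in> X" for x
    proof -
      have "{V \<in> \<V>. x \<notin> V} = W ` {c \<in> a. x \<notin> W c}" using \<V> by auto
      then show ?thesis using fin[OF that] by simp
    qed
    then have "tau_cover X \<V>"
      using tau_cover_if_cofinite[OF inf] mem by blast
    moreover have "countable \<V>" "borel_family X \<V>"
      using countable_subset[OF \<F>sub cnt] \<F>sub bor unfolding \<V>_def borel_family_def
      by (simp, blast)
    ultimately show ?thesis by (simp add: \<V>_def B_Tau_def)
  qed
  ultimately show "\<exists>\<F>. (\<forall>n. finite (\<F> n) \<and> \<F> n \<subseteq> \<U> n) \<and> (\<Union>n. \<F> n) \<in> B_Tau X"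
    by blast
qed

lemma open_family_imp_borel_family: "open_family X \<U> \<Longrightarrow> borel_family X \<U>"
  unfolding open_family_def borel_family_def
  by (force simp: openin_open sets_restrict_space)

text \<open>Sets selected from open covers are open, so the Borel \<tau>-cover obtained from them is
  already an open one.\<close>

lemma S_fin_Omega_Tau_if_S_fin_B_Omega_B_Tau:
  assumes "S_fin B_Omega B_Tau X"
  shows "S_fin Omega Tau X"
  unfolding S_fin_def
proof (intro allI impI)
  fix \<U> :: "nat \<Rightarrow> real set set"
  assume \<U>: "\<forall>n. \<U> n \<in> Omega X"
  then have "\<forall>n. \<U> n \<in> B_Omega X"
    by (auto simp: Omega_def B_Omega_def open_family_imp_borel_family)
  then obtain \<F> where \<F>: "\<forall>n. finite (\<F> n) \<and> \<F> n \<subseteq> \<U> n" "(\<Union>n. \<F> n) \<in> B_Tau X"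
    using assms unfolding S_fin_def by blast
  moreover have "open_family X (\<Union>n. \<F> n)"
    using \<U> \<F>(1) unfolding Omega_def open_family_def by blast
  ultimately have "(\<Union>n. \<F> n) \<in> Tau X" by (simp add: B_Tau_def Tau_def)
  then show "\<exists>\<F>. (\<forall>n. finite (\<F> n) \<and> \<F> n \<subseteq> \<U> n) \<and> (\<Union>n. \<F> n) \<in> Tau X"
    using \<F>(1) by blast
qed

section \<open>The upper bound\<close>

text \<open>This puts families of sets of naturals on the real line with relatively open coordinate
  sets. Base 4 with digits 0 and 1 leaves gaps, so an open condition can read off each
  digit.\<close>

lemma open_sets_tracing_all_subsets:
  "\<exists>(e :: nat set \<Rightarrow> real) V. (\<forall>n :: nat. open (V n)) \<and> (\<forall>y n. e y \<in> V n \<longleftrightarrow> n \<in> y)"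
proof -
  define d where "d y k = (if k \<in> y then 1 else 0 :: real) / 4 ^ Suc k" for y and k :: nat
  define e where "e y = suminf (d y)" for y
  \<comment> \<open>The fractional part of \<open>4 ^ n * e y\<close> is at least \<open>1/4\<close> if \<open>n \<in> y\<close> and at most
    \<open>\<Sum>k\<ge>2. 4 ^ (-k) = 1/12\<close> otherwise.\<close>
  define V where "V n = (\<Union>m::int. (\<lambda>x. 4 ^ n * x) -` {real_of_int m + 1/8 <..< real_of_int m + 1})" for n :: nat
  have geo: "(\<lambda>k. (1/4) ^ k * (1 / 4 ^ Suc j)) sums (1 / (3 * 4 ^ j) :: real)" for j
    using sums_mult2[OF geometric_sums[of "1/4 :: real"], of "1 / 4 ^ Suc j"] by simp
  have dle: "d y (k + j) \<le> (1/4) ^ k * (1 / 4 ^ Suc j)" and d0: "0 \<le> d y k" for y k j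
    by (auto simp: d_def power_add field_simps)
  have summ: "summable (\<lambda>k. d y (k + j))" for y j
    by (rule summable_comparison_test'[OF sums_summable[OF geo[of j]]])
       (use dle d0 in auto)
  have tail0: "0 \<le> (\<Sum>k. d y (k + j))" for y j
    by (rule suminf_nonneg[OF summ d0])
  have tail: "(\<Sum>k. d y (k + j)) \<le> 1 / (3 * 4 ^ j)" for y j
    unfolding sums_unique[OF geo[of j]]
    by (rule suminf_le[OF dle summ sums_summable[OF geo[of j]]])
  have int: "\<exists>m::int. 4 ^ n * (\<Sum>k<n. d y k) = m" for y n
  proof (induction n)
    case (Suc n)
    then obtain m :: int where m: "4 ^ n * (\<Sum>k<n. d y k) = m" by blast
    have "4 ^ Suc n * (\<Sum>k<Suc n. d y k) = 4 * (4 ^ n * (\<Sum>k<n. d y k)) + (if n \<in> y then 1 else 0)"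
      by (simp add: d_def algebra_simps)
    also have "\<dots> = of_int (4 * m + (if n \<in> y then 1 else 0))" unfolding m by simp
    finally show ?case by blast
  qed simp
  have "open (V n)" for n
    unfolding V_def
    by (intro open_UN ballI open_vimage continuous_intros)
  moreover have "e y \<in> V n \<longleftrightarrow> n \<in> y" for y n
  proof -
    define t where "t = 4 ^ n * (\<Sum>k. d y (k + Suc n))"
    obtain m :: int where m: "4 ^ n * (\<Sum>k<n. d y k) = m" using int by blast
    have "e y = (\<Sum>k. d y (k + Suc n)) + (\<Sum>k<Suc n. d y k)"
      unfolding e_def using suminf_split_initial_segment[OF summ[of y 0, simplified]] by blast
    then have "4 ^ n * e y = t + m + 4 ^ n * d y n"
      unfolding t_def by (simp add: m[symmetric] distrib_left)
    then have e: "4 ^ n * e y = m + (if n \<in> y then 1/4 else 0) + t"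
      by (simp add: d_def)
    have "t \<le> 4 ^ n * (1 / (3 * 4 ^ Suc n))"
      unfolding t_def by (intro mult_left_mono tail) auto
    then have t: "0 \<le> t" "t \<le> 1/12"
      using tail0[of y "Suc n"] by (auto simp: t_def)
    show ?thesis
    proof
      assume "n \<in> y"
      then have "4 ^ n * e y \<in> {real_of_int m + 1/8 <..< real_of_int m + 1}" using e t by auto
      then show "e y \<in> V n" unfolding V_def by (intro UN_I[of m] vimageI2) auto
    next
      assume "e y \<in> V n"
      then obtain l :: int where l: "l + 1/8 < 4 ^ n * e y" "4 ^ n * e y < l + 1"
        unfolding V_def by auto
      show "n \<in> y"
      proof (rule ccontr)
        assume "n \<notin> y"
        \<comment> \<open>Here \<open>4 ^ n * e y = m + t\<close> with \<open>t\<close> at most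
          1/12, which is below the threshold 1/8. No integer fits between \<open>l\<close> and
          \<open>l + 1\<close>.\<close>
        then have "real_of_int l < of_int m" "real_of_int m < of_int (l + 1)" using l e t by auto
        then show False by (simp only: of_int_less_iff)
      qed
    qed
  qed
  ultimately show ?thesis by (intro exI[of _ e] exI[of _ V]) simp
qed

text \<open>The added set \<open>u \<union> - v\<close> is where membership in \<open>v\<close>
  implies membership in \<open>u\<close>. It turns a comparison modulo finite into almost
  containment of \<open>a \<inter> v\<close> in \<open>u\<close>.\<close>

lemma not_linear_on_centered_extension:
  assumes Y: "\<not> (\<exists>a. pseudo_intersection a Y)"
    and Y': "Y' = Y \<union> (\<lambda>(u, v). u \<union> - v) ` (Y \<times> Y)"
    and inf: "\<And>y. y \<in> Y' \<Longrightarrow> infinite (a \<inter> y)"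
    and lin: "\<And>x y. x \<in> Y' \<Longrightarrow> y \<in> Y' \<Longrightarrow> finite (a \<inter> x - y) \<or> finite (a \<inter> y - x)"
  shows False
proof (cases "Y = {}")
  case True
  then show False using Y unfolding pseudo_intersection_def by blast
next
  case False
  then have "infinite a" using inf Y' by (metis UnI1 equals0I finite_Int)
  then obtain v where v: "v \<in> Y" "infinite (a - v)"
    using Y unfolding pseudo_intersection_def by blast
  have "finite (a \<inter> v - u)" if "u \<in> Y" for u
  proof -
    \<comment> \<open>The second set contains the infinite set \<open>a - v\<close>, so the first
      one is finite, and it equals \<open>a \<inter> v - u\<close>.\<close>
    have "finite (a \<inter> v - (u \<union> - v)) \<or> finite (a \<inter> (u \<union> - v) - v)"
      using lin[of v "u \<union> - v"] v that Y' by auto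
    moreover have "a - v \<subseteq> a \<inter> (u \<union> - v) - v" "a \<inter> v - (u \<union> - v) = a \<inter> v - u" by auto
    ultimately show ?thesis using v(2) finite_subset by auto
  qed
  moreover have "infinite (a \<inter> v)" using inf v(1) Y' by blast
  ultimately show False using Y unfolding pseudo_intersection_def by blast
qed

lemma ex_not_S_fin_Omega_Tau:
  assumes cen: "centered Y" and Y: "\<not> (\<exists>a. pseudo_intersection a Y)"
  shows "\<exists>X. infinite X \<and> \<not> S_fin Omega Tau X \<and> |X| =o |Y|"
proof -
  have fip: "infinite (\<Inter>F)" if "finite F" "F \<subseteq> Y" for F
    using cen that unfolding centered_def by (cases "F = {}") auto
  \<comment> \<open>This is what keeps \<open>Y'\<close> at the size of \<open>Y\<close>. A finite
    centered family has its own intersection as a pseudo-intersection.\<close>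
  have "infinite Y"
  proof
    assume "finite Y"
    then have "pseudo_intersection (\<Inter>Y) Y"
      using fip unfolding pseudo_intersection_def by (auto intro: finite_subset[of _ "{}"])
    then show False using Y by blast
  qed
  define Y' where "Y' = Y \<union> (\<lambda>(u, v). u \<union> - v) ` (Y \<times> Y)"
  have Y'sup: "\<exists>u\<in>Y. u \<subseteq> y" if "y \<in> Y'" for y
    using that unfolding Y'_def by auto
  have fip': "infinite (\<Inter>F)" if F: "finite F" "F \<subseteq> Y'" for F
  proof -
    obtain s where s: "\<And>y. y \<in> Y' \<Longrightarrow> s y \<in> Y \<and> s y \<subseteq> y" using Y'sup by metis
    have "infinite (\<Inter>(s ` F))" using fip[of "s ` F"] F s by blast
    moreover have "\<Inter>(s ` F) \<subseteq> \<Inter>F" using s F by blast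
    ultimately show ?thesis using infinite_super by blast
  qed
  \<comment> \<open>Coordinates in \<open>\<Inter>Y'\<close> give the whole space, which must not be
    a member of the cover. Since they are finitely many, every finite intersection from
    \<open>Y'\<close> still offers another coordinate.\<close>
  have "finite (\<Inter>Y)"
  proof (rule ccontr)
    assume "infinite (\<Inter>Y)"
    then have "pseudo_intersection (\<Inter>Y) Y"
      unfolding pseudo_intersection_def by (auto intro: finite_subset[of _ "{}"])
    then show False using Y by blast
  qed
  then have finI: "finite (\<Inter>Y')" by (rule rev_finite_subset) (auto simp: Y'_def)
  have cY': "|Y'| =o |Y|"
  proof -
    have "|(\<lambda>(u, v). u \<union> - v) ` (Y \<times> Y)| \<le>o |Y|"
      using ordLeq_ordIso_trans[OF card_of_image card_of_Times_same_infinite[OF \<open>infinite Y\<close>]] .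
    moreover have "|Y| \<le>o |Y|" by (rule card_of_mono1) simp
    ultimately have "|Y'| \<le>o |Y|"
      unfolding Y'_def using \<open>infinite Y\<close> by (intro card_of_Un_ordLeq_infinite_Field)
        (simp_all add: Field_card_of card_of_card_order_on)
    moreover have "|Y| \<le>o |Y'|" by (rule card_of_mono1) (simp add: Y'_def)
    ultimately show ?thesis by (simp add: ordIso_iff_ordLeq)
  qed
  obtain V and e :: "nat set \<Rightarrow> real" where V: "\<And>n. open (V n)" and eV: "\<And>y n. e y \<in> V n \<longleftrightarrow> n \<in> y"
    using open_sets_tracing_all_subsets by metis
  have inje: "inj e"
  proof (rule injI)
    fix x y assume "e x = e y"
    then have "n \<in> x \<longleftrightarrow> n \<in> y" for n using eV[of x n] eV[of y n] by simp
    then show "x = y" by blast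
  qed
  define X where "X = e ` Y'"
  have "|X| =o |Y'|"
    unfolding X_def using inje
    by (intro ordIso_symmetric[OF card_of_ordIsoI[OF inj_on_imp_bij_betw]]) (rule inj_on_subset, auto)
  then have cX: "|X| =o |Y|" using cY' by (rule ordIso_transitive)
  then have "infinite X" using \<open>infinite Y\<close> card_of_ordIso_finite by blast
  define U where "U n = X \<inter> V n" for n
  have eU: "e y \<in> U n \<longleftrightarrow> n \<in> y" if "y \<in> Y'" for y n
    using that eV by (auto simp: U_def X_def)
  define \<U> where "\<U> = range U - {X}"
  have \<omega>: "\<exists>W\<in>\<U>. F \<subseteq> W" if F: "finite F" "F \<subseteq> X" for F
  proof -
    obtain F' where F': "F' \<subseteq> Y'" "finite F'" "F = e ` F'"
      using F unfolding X_def by (metis finite_subset_image)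
    have "infinite (\<Inter>F' - \<Inter>Y')" using fip' F' finI by simp
    then obtain n where n: "n \<in> \<Inter>F'" "n \<notin> \<Inter>Y'" by (metis Diff_iff ex_in_conv finite.emptyI)
    obtain y where y: "y \<in> Y'" "n \<notin> y" using n(2) by blast
    then have "e y \<in> X" "e y \<notin> U n" using eU by (auto simp: X_def)
    moreover have "F \<subseteq> U n" using F' eU n(1) by blast
    ultimately have "F \<subseteq> U n" "U n \<noteq> X" by auto
    then show ?thesis by (auto simp: \<U>_def)
  qed
  have "x \<in> \<Union>\<U>" if "x \<in> X" for x using \<omega>[of "{x}"] that by auto
  then have "\<Union>\<U> = X" by (auto simp: \<U>_def U_def)
  then have "omega_cover X \<U>"
    unfolding omega_cover_def is_cover_def using \<omega> by (simp add: \<U>_def)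
  moreover have "open_family X \<U>"
    using V by (auto simp: open_family_def \<U>_def U_def openin_open)
  ultimately have \<U>: "\<U> \<in> Omega X" by (simp add: Omega_def \<U>_def)
  have "\<not> S_fin Omega Tau X"
  proof
    assume "S_fin Omega Tau X"
    \<comment> \<open>For the constant sequence, the union of a selection is merely a subfamily of
      \<U>.\<close>
    then obtain \<F> :: "nat \<Rightarrow> real set set"
      where \<F>: "\<forall>n. finite (\<F> n) \<and> \<F> n \<subseteq> \<U>" "(\<Union>n. \<F> n) \<in> Tau X"
      unfolding S_fin_def using \<U> by (elim allE[of _ "\<lambda>_. \<U>"]) blast
    have "(\<Union>n. \<F> n) \<subseteq> range U" using \<F>(1) unfolding \<U>_def by blast
    \<comment> \<open>Distinct indices may give equal coordinate sets. With one index kept per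
      selected set, counting members of the cover amounts to counting elements of
      \<open>a\<close>.\<close>
    then obtain a where a: "inj_on U a" "(\<Union>n. \<F> n) = U ` a"
      by (metis subset_image_inj)
    have tau: "tau_cover X (U ` a)" using \<F>(2) a(2) by (simp add: Tau_def)
    have tr: "finite {W \<in> U ` a. P W} \<longleftrightarrow> finite {n \<in> a. P (U n)}" for P
    proof -
      have "{W \<in> U ` a. P W} = U ` {n \<in> a. P (U n)}" by auto
      moreover have "inj_on U {n \<in> a. P (U n)}" using a(1) by (auto intro: inj_on_subset)
      ultimately show ?thesis by (simp add: finite_image_iff)
    qed
    show False
    proof (rule not_linear_on_centered_extension[OF Y Y'_def, of a])
      fix y assume "y \<in> Y'"
      then have "infinite {W \<in> U ` a. e y \<in> W}"
        using tau unfolding tau_cover_def large_cover_def X_def by blast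
      then show "infinite (a \<inter> y)" unfolding tr using eU[OF \<open>y \<in> Y'\<close>] by (simp add: Int_def)
    next
      fix x y assume xy: "x \<in> Y'" "y \<in> Y'"
      then have "e x \<in> X" "e y \<in> X" by (auto simp: X_def)
      then have "finite {W \<in> U ` a. \<not> (e x \<in> W \<longrightarrow> e y \<in> W)} \<or>
          finite {W \<in> U ` a. \<not> (e y \<in> W \<longrightarrow> e x \<in> W)}"
        using tau unfolding tau_cover_def by blast
      moreover have "{n \<in> a. \<not> (n \<in> x \<longrightarrow> n \<in> y)} = a \<inter> x - y" for x y by auto
      ultimately show "finite (a \<inter> x - y) \<or> finite (a \<inter> y - x)"
        unfolding tr eU[OF xy(1)] eU[OF xy(2)] by simp
    qed
  qed
  then show ?thesis using \<open>infinite X\<close> cX by blast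
qed

section \<open>Existence of the pseudo-intersection number\<close>

text \<open>The witness is the filter \<open>Fin \<otimes> Fin\<close> on \<open>\<nat> \<times> \<nat>\<close>: a pseudo-intersection has finite columns, so
  some function lies above it.\<close>

lemma ex_centered_no_pseudo_intersection:
  "\<exists>Y. centered Y \<and> \<not> (\<exists>a. pseudo_intersection a Y)"
proof -
  define B where "B k f = {c. k \<le> fst (prod_decode c) \<and> f (fst (prod_decode c)) \<le> snd (prod_decode c)}"
    for k and f :: "nat \<Rightarrow> nat"
  define Y where "Y = range (case_prod B)"
  have fip: "\<exists>k f. B k f \<subseteq> \<Inter>F" if "finite F" "F \<subseteq> Y" for F
    using that
  proof (induction F)
    case (insert b F)
    then obtain k f k' f' where "B k f \<subseteq> \<Inter>F" "b = B k' f'" unfolding Y_def by auto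
    moreover have "B (max k k') (\<lambda>n. max (f n) (f' n)) \<subseteq> B k f \<inter> B k' f'" by (auto simp: B_def)
    ultimately have "B (max k k') (\<lambda>n. max (f n) (f' n)) \<subseteq> \<Inter>(insert b F)" by auto
    then show ?case by blast
  qed auto
  have infB: "infinite (B k f)" for k f
  proof -
    have "inj (\<lambda>i. prod_encode (k, f k + i))" by (auto simp: inj_def)
    then have "infinite (range (\<lambda>i. prod_encode (k, f k + i)))" by (simp add: finite_image_iff)
    moreover have "range (\<lambda>i. prod_encode (k, f k + i)) \<subseteq> B k f" by (auto simp: B_def)
    ultimately show ?thesis using infinite_super by blast
  qed
  have fip': "infinite (\<Inter>F)" if F: "finite F" "F \<subseteq> Y" for F
  proof -
    obtain k f where "B k f \<subseteq> \<Inter>F" using fip[OF F] by blast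
    then show ?thesis using infB infinite_super by blast
  qed
  have "centered Y" unfolding centered_def using fip' fip'[of "{_}"] by simp
  moreover have "\<not> pseudo_intersection a Y" for a
  proof
    assume a: "pseudo_intersection a Y"
    have fin: "finite (a - B k f)" for k f
    proof -
      have "B k f \<in> Y" unfolding Y_def by (auto intro: image_eqI[of _ _ "(k, f)"])
      then show ?thesis using a unfolding pseudo_intersection_def by blast
    qed
    have "finite {m. prod_encode (n, m) \<in> a}" for n
      by (rule finite_column) (use fin[of "Suc n" "\<lambda>_. 0"] in \<open>simp add: B_def\<close>)
    then have "\<exists>j. \<forall>m. prod_encode (n, m) \<in> a \<longrightarrow> m < j" for n
      unfolding finite_nat_set_iff_bounded by blast
    then obtain f where f: "\<And>n m. prod_encode (n, m) \<in> a \<Longrightarrow> m < f n" by metis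
    \<comment> \<open>\<open>f\<close> lies strictly above every column of \<open>a\<close>, so
      \<open>a\<close> is disjoint from \<open>B 0 f\<close>, in which it should be almost
      contained.\<close>
    have "a - B 0 f = a"
    proof -
      have "c \<notin> B 0 f" if "c \<in> a" for c
        using f[of "fst (prod_decode c)" "snd (prod_decode c)"] that by (simp add: B_def)
      then show ?thesis by blast
    qed
    then show False using fin[of 0 f] a unfolding pseudo_intersection_def by simp
  qed
  ultimately show ?thesis by blast
qed

text \<open>The minimum must be attained. Cardinal orders are well-founded, so a nonempty class of
  them has a least one.\<close>

lemma ex_is_pseudointersection_number:
  "\<exists>\<kappa> :: nat set rel. is_pseudointersection_number \<kappa>"
proof -
  define R where "R = {|Y| | Y :: nat set set. centered Y \<and> \<not> (\<exists>a. pseudo_intersection a Y)}"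
  have "R \<noteq> {}" using ex_centered_no_pseudo_intersection unfolding R_def by blast
  moreover have "\<forall>r\<in>R. Card_order r" by (auto simp: R_def card_of_Card_order)
  ultimately obtain r where "r \<in> R" "\<forall>r'\<in>R. r \<le>o r'" using exists_minim_Card_order by blast
  then have "is_pseudointersection_number r"
    unfolding is_pseudointersection_number_def is_min_card_def R_def
    using card_of_Card_order ordIso_reflexive card_of_refl by blast
  then show ?thesis ..
qed

section \<open>The critical cardinalities of both selection properties\<close>

theorem theorem4p7:
  "\<exists>\<pp> :: nat set rel.
     is_pseudointersection_number \<pp> \<and>
     is_non (S_fin Omega Tau) \<pp> \<and>
     is_non (S_fin B_Omega B_Tau) \<pp>"
proof -
  obtain \<kappa> :: "nat set rel" where \<kappa>: "is_pseudointersection_number \<kappa>"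
    using ex_is_pseudointersection_number by blast
  then obtain Y where Y: "centered Y" "\<not> (\<exists>a. pseudo_intersection a Y)" "|Y| =o \<kappa>"
    and card: "Card_order \<kappa>"
    and min: "\<And>Y. centered Y \<Longrightarrow> \<not> (\<exists>a. pseudo_intersection a Y) \<Longrightarrow> \<kappa> \<le>o |Y|"
    unfolding is_pseudointersection_number_def is_min_card_def by blast
  obtain X where X: "infinite X" "\<not> S_fin Omega Tau X" "|X| =o |Y|"
    using ex_not_S_fin_Omega_Tau[OF Y(1,2)] by blast
  have X\<kappa>: "|X| =o \<kappa>" using X(3) Y(3) by (rule ordIso_transitive)
  have lower: "\<kappa> \<le>o |A|" if A: "infinite A" "\<not> S_fin B_Omega B_Tau A" for A
  proof -
    obtain Z :: "nat set set" where "|Z| \<le>o |A|" "centered Z" "\<not> (\<exists>a. pseudo_intersection a Z)"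
      using S_fin_B_Omega_B_Tau_if_pseudo_intersections[OF A(1)] A(2) by blast
    then show ?thesis using min ordLeq_transitive by blast
  qed
  \<comment> \<open>The Borel property implies the open one. Hence \<open>X\<close> fails both, and
    the lower bound for sets failing the Borel property covers those failing the open one.\<close>
  have "is_non (S_fin Omega Tau) \<kappa>" "is_non (S_fin B_Omega B_Tau) \<kappa>"
    unfolding is_non_def is_min_card_def
    using card X X\<kappa> lower S_fin_Omega_Tau_if_S_fin_B_Omega_B_Tau by blast+
  then show ?thesis using \<kappa> by blast
qed

end
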